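(* Consider an instance of the CAPCAB in which the acceptance behavior of occasional drivers is modeled using the logistic acceptance probability function $$P_{ij}(C_{ij})=\begin{cases}0 & \text{if } C_{ij}=0,\\ \dfrac{1}{1+e^{-(\gamma_{ij}+\delta_{ij}C_{ij})}} & \text{otherwise,}\end{cases}\qquad i\in I,\ j\in J.$$ There exists an optimal solution to that instance with compensation values $$C_{ij}^*=-\frac{W\bigl(e^{\gamma_{ij}+\delta_{ij}c'_i-1}\bigr)-\delta_{ij}c'_i+1}{\delta_{ij}}$$ for each task $i\in I$ and occasional driver $j\in J$, in which $W(\cdot)$ is the Lambert $W$ function.
   Context: An instance of the Crowdshipping Assignment Problem with Compensation-Driven Acceptance Behavior (CAPCAB) consists of a finite set $I$ of tasks, a finite set $J$ of occasional drivers, costs $c_i'\ge c_i\ge 0$ for each $i\in I$ ($c_i$ is the cost of having task $i$ performed by a professional driver, $c_i'$ the penalized cost incurred if task $i$ is refused by an occasional driver), and, for each $i\in I$, $j\in J$, an acceptance probability function $P_{ij}:[0,\infty)\to[0,1]$ with $P_{ij}(0)=0$, where $P_{ij}(C_{ij})$ is the probability that driver $j$ accepts task $i$ when offered compensation $C_{ij}$, independently of other tasks, drivers, compensations and decisions. In the logistic model, $\gamma_{ij}$ is a real parameter subsuming the impact of all predictors other than the compensation, and $\delta_{ij}>0$. A feasible solution consists of a one-to-one assignment $A\subseteq I\times J$ of offered pairs (each task and each driver occurs in at most one pair of $A$) and compensations $C_{ij}\ge 0$. There are no further constraints on the operator's choice. Let $I_{\mathrm o}=\{i : (i,j)\in A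 \text{ for some } j\}$. The expected total cost of the solution is $$\sum_{i\in I\setminus I_{\mathrm o}} c_i+\sum_{(i,j)\in A}\bigl(P_{ij}(C_{ij})\,C_{ij}+(1-P_{ij}(C_{ij}))\,c_i'\bigr).$$ An optimal solution is a feasible solution of minimum expected total cost. The Lambert $W$ function is taken real-valued, $W(ze^z)=z$; for $b>0$, $W(b)$ is the unique real $z$ with $ze^z=b$.
   Formalization: Added assumption: all C*_ij are positive, or some optimal solution exists (without it an optimum may fail to exist, e.g. one task, one driver, c=c'=1, γ=0, δ=1). Compensations must be nonnegative only for offered pairs. *)

theory Defs
  imports Complex_Main
begin

text \<open>
  In \<open>capcab\<close>, \<open>c' i\<close> is the penalized cost of a refused task and \<open>P i j x\<close> the probability
  that driver \<open>j\<close> accepts task \<open>i\<close> when offered compensation \<open>x\<close>.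
\<close>

definition capcab ::
    "'i set \<Rightarrow> 'j set \<Rightarrow> ('i \<Rightarrow> real) \<Rightarrow> ('i \<Rightarrow> real) \<Rightarrow> ('i \<Rightarrow> 'j \<Rightarrow> real \<Rightarrow> real) \<Rightarrow> bool" where
  "capcab I J c c' P \<longleftrightarrow>
     finite I \<and> finite J \<and>
     (\<forall>i\<in>I. 0 \<le> c i \<and> c i \<le> c' i) \<and>
     (\<forall>i\<in>I. \<forall>j\<in>J. P i j 0 = 0 \<and> (\<forall>x\<ge>0. 0 \<le> P i j x \<and> P i j x \<le> 1))"

definition one_to_one_assignment :: "'i set \<Rightarrow> 'j set \<Rightarrow> ('i \<times> 'j) set \<Rightarrow> bool" where
  "one_to_one_assignment I J A \<longleftrightarrow> A \<subseteq> I \<times> J \<and> inj_on fst A \<and> inj_on snd A"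

text \<open>
  Only compensations that are offered are constrained; \<open>C i j\<close> for \<open>(i, j) \<notin> A\<close> is never paid
  and does not enter the expected cost.
\<close>

definition feasible_solution ::
    "'i set \<Rightarrow> 'j set \<Rightarrow> ('i \<times> 'j) set \<Rightarrow> ('i \<Rightarrow> 'j \<Rightarrow> real) \<Rightarrow> bool" where
  "feasible_solution I J A C \<longleftrightarrow>
     one_to_one_assignment I J A \<and> (\<forall>(i, j)\<in>A. 0 \<le> C i j)"

definition expected_cost ::
    "'i set \<Rightarrow> ('i \<Rightarrow> real) \<Rightarrow> ('i \<Rightarrow> real) \<Rightarrow> ('i \<Rightarrow> 'j \<Rightarrow> real \<Rightarrow> real) \<Rightarrow>
     ('i \<times> 'j) set \<Rightarrow> ('i \<Rightarrow> 'j \<Rightarrow> real) \<Rightarrow> real" where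
  "expected_cost I c c' P A C =
     (\<Sum>i \<in> I - fst ` A. c i) +
     (\<Sum>(i, j) \<in> A. P i j (C i j) * C i j + (1 - P i j (C i j)) * c' i)"

definition optimal_solution ::
    "'i set \<Rightarrow> 'j set \<Rightarrow> ('i \<Rightarrow> real) \<Rightarrow> ('i \<Rightarrow> real) \<Rightarrow> ('i \<Rightarrow> 'j \<Rightarrow> real \<Rightarrow> real) \<Rightarrow>
     ('i \<times> 'j) set \<Rightarrow> ('i \<Rightarrow> 'j \<Rightarrow> real) \<Rightarrow> bool" where
  "optimal_solution I J c c' P A C \<longleftrightarrow>
     feasible_solution I J A C \<and>
     (\<forall>A' C'. feasible_solution I J A' C' \<longrightarrow>
        expected_cost I c c' P A C \<le> expected_cost I c c' P A' C')"

definition logistic_acceptance ::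
    "('i \<Rightarrow> 'j \<Rightarrow> real) \<Rightarrow> ('i \<Rightarrow> 'j \<Rightarrow> real) \<Rightarrow> 'i \<Rightarrow> 'j \<Rightarrow> real \<Rightarrow> real" where
  "logistic_acceptance \<gamma> \<delta> i j x =
     (if x = 0 then 0 else 1 / (1 + exp (- (\<gamma> i j + \<delta> i j * x))))"

text \<open>Only used for \<open>b > 0\<close>, where the solution is unique.\<close>

definition lambert_W :: "real \<Rightarrow> real" where
  "lambert_W b = (THE z. z * exp z = b)"

text \<open>
  The value below can be negative or zero. Since the logistic acceptance probability jumps to 0
  at compensation 0, an infimum of the expected cost need then not be attained: with one task,
  one driver, \<open>c = c' = 1\<close>, \<open>\<gamma> = 0\<close>, \<open>\<delta> = 1\<close>, the cost of offering \<open>x > 0\<close> exceeds 1/2 and tends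
  to 1/2 as \<open>x\<close> decreases to 0, while not offering, or offering 0, costs 1.
\<close>

definition logistic_compensation ::
    "('i \<Rightarrow> real) \<Rightarrow> ('i \<Rightarrow> 'j \<Rightarrow> real) \<Rightarrow> ('i \<Rightarrow> 'j \<Rightarrow> real) \<Rightarrow> 'i \<Rightarrow> 'j \<Rightarrow> real" where
  "logistic_compensation c' \<gamma> \<delta> i j =
     - ((lambert_W (exp (\<gamma> i j + \<delta> i j * c' i - 1)) - \<delta> i j * c' i + 1) / \<delta> i j)"

end

theory Submission
  imports Defs
begin

text \<open>
  Put \<open>K = C\<^sup>*\<close> and \<open>W = W(exp (\<gamma> + \<delta> c' - 1))\<close>. The defining equation of \<open>W\<close> says
  \<open>exp (\<gamma> + \<delta> K) = W\<close> and \<open>\<delta> (c' - K) = 1 + W\<close>. In the variable \<open>t = \<delta> (x - K)\<close> the expected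
  cost of offering \<open>x > 0\<close> is \<open>c' - W (1 + W - t) / (\<delta> (exp (-t) + W))\<close>, so minimality at
  \<open>t = 0\<close> is the inequality \<open>1 - t \<le> exp (-t)\<close>, and the cost is strictly increasing for \<open>t \<ge> 0\<close>.
  Hence if \<open>K \<le> 0\<close>, an optimal solution can offer only \<open>0\<close> on that pair, at cost \<open>c' \<ge> c\<close>, and the
  pair may be dropped from the assignment. On the remaining pairs \<open>K\<close> is feasible and optimal.
\<close>

lemma lambert_W_pos_arg:
  assumes "0 < b"
  shows lambert_W_eq: "lambert_W b * exp (lambert_W b) = b"
    and lambert_W_pos: "0 < lambert_W b"
proof -
  have "\<exists>z\<ge>0. z \<le> b \<and> z * exp z = b"
  proof (rule IVT)
    show "b \<le> b * exp b" using assms by simp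
  qed (use assms in \<open>auto intro!: continuous_intros\<close>)
  then obtain z where z: "z * exp z = b" by blast
  have pos: "0 < y" if "y * exp y = b" for y :: real
    using that assms by (metis exp_gt_zero zero_less_mult_pos2)
  have mono: "x * exp x < y * exp y" if "0 < x" "x < y" for x y :: real
    using that by (intro mult_strict_mono) auto
  have uniq: "y = z" if "y * exp y = b" for y
    using mono[of y z] mono[of z y] pos[OF that] pos[OF z] that z by force
  have "lambert_W b = z"
    unfolding lambert_W_def using z uniq by (rule the_equality)
  then show "lambert_W b * exp (lambert_W b) = b" "0 < lambert_W b"
    using z pos by auto
qed

lemma saving_strict_antimono:
  fixes s t w :: real
  assumes "0 \<le> s" "s < t" "0 < w"
  shows "(1 + w - t) / (exp (- t) + w) < (1 + w - s) / (exp (- s) + w)"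
proof -
  have "0 < (1 + w - s) * (exp (- t) - exp (- s)) + (t - s) * (exp (- s) + w)"
  proof (cases "0 < 1 + w - s")
    case True
    have "exp (- s) * (1 - (t - s)) < exp (- s) * exp (- (t - s))"
      using exp_minus_greater[of "t - s"] assms by simp
    also have "\<dots> = exp (- t)" by (simp flip: exp_add)
    finally have "- ((t - s) * exp (- s)) < exp (- t) - exp (- s)"
      by (simp add: algebra_simps)
    then have "(1 + w - s) * (- ((t - s) * exp (- s))) < (1 + w - s) * (exp (- t) - exp (- s))"
      using True by (rule mult_strict_left_mono)
    moreover have "0 \<le> (t - s) * (w * (1 - exp (- s)) + s * exp (- s))"
      using assms by simp
    ultimately show ?thesis by (simp add: algebra_simps)
  next
    case False
    then have "0 \<le> (1 + w - s) * (exp (- t) - exp (- s))"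
      using assms by (intro mult_nonpos_nonpos) auto
    moreover have "0 < (t - s) * (exp (- s) + w)"
      using assms by (simp add: add_pos_pos)
    ultimately show ?thesis by linarith
  qed
  moreover have "0 < exp (- s) + w" "0 < exp (- t) + w"
    using assms by (simp_all add: add_pos_pos)
  ultimately show ?thesis
    by (simp add: divide_less_eq less_divide_eq) (simp add: algebra_simps)
qed

definition offer_cost :: "('i \<Rightarrow> real) \<Rightarrow> ('i \<Rightarrow> 'j \<Rightarrow> real \<Rightarrow> real) \<Rightarrow> 'i \<Rightarrow> 'j \<Rightarrow> real \<Rightarrow> real" where
  "offer_cost c' P i j x = P i j x * x + (1 - P i j x) * c' i"

lemma expected_cost_eq:
  assumes "finite I" "one_to_one_assignment I J A"
  shows "expected_cost I c c' P A C =
    sum c I + (\<Sum>(i, j)\<in>A. offer_cost c' P i j (C i j) - c i)"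
proof -
  have sub: "fst ` A \<subseteq> I" and inj: "inj_on fst A"
    using assms(2) by (auto simp: one_to_one_assignment_def)
  have "sum c (I - fst ` A) = sum c I - sum c (fst ` A)"
    using assms(1) sub by (simp add: sum_diff finite_subset)
  also have "sum c (fst ` A) = (\<Sum>(i, j)\<in>A. c i)"
    using inj by (simp add: sum.reindex case_prod_unfold)
  finally show ?thesis
    by (simp add: expected_cost_def offer_cost_def case_prod_unfold sum_subtractf)
qed

context
  fixes c' :: "'i \<Rightarrow> real" and \<gamma> \<delta> :: "'i \<Rightarrow> 'j \<Rightarrow> real" and i :: 'i and j :: 'j
  assumes \<delta>_pos: "0 < \<delta> i j"
begin

abbreviation (input) "K \<equiv> logistic_compensation c' \<gamma> \<delta> i j"
abbreviation (input) "w \<equiv> lambert_W (exp (\<gamma> i j + \<delta> i j * c' i - 1))"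
abbreviation (input) "cost \<equiv> offer_cost c' (logistic_acceptance \<gamma> \<delta>) i j"

lemma offer_cost_logistic:
  assumes "x \<noteq> 0"
  defines "t \<equiv> \<delta> i j * (x - K)"
  shows "cost x = c' i - w / \<delta> i j * ((1 + w - t) / (exp (- t) + w))"
proof -
  have w: "w * exp w = exp (\<gamma> i j + \<delta> i j * c' i - 1)" "0 < w"
    by (simp_all add: lambert_W_eq lambert_W_pos)
  have \<delta>K: "\<delta> i j * K = \<delta> i j * c' i - 1 - w"
    using \<delta>_pos by (simp add: logistic_compensation_def)
  have "exp (\<gamma> i j + \<delta> i j * K) * exp w = w * exp w"
    unfolding w(1) \<delta>K by (simp flip: exp_add)
  then have "exp (\<gamma> i j + \<delta> i j * K) = w" by simp
  moreover have "\<gamma> i j + \<delta> i j * x = (\<gamma> i j + \<delta> i j * K) + t"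
    by (simp add: t_def algebra_simps)
  ultimately have "exp (- (\<gamma> i j + \<delta> i j * x)) = exp (- t) / w"
    by (simp only: exp_minus exp_add) (simp add: field_simps)
  then have "1 + exp (- (\<gamma> i j + \<delta> i j * x)) = (exp (- t) + w) / w"
    using w(2) by (simp add: add_divide_distrib)
  then have P: "logistic_acceptance \<gamma> \<delta> i j x = w / (exp (- t) + w)"
    using assms(1) by (simp add: logistic_acceptance_def)
  have "c' i - x = (1 + w - t) / \<delta> i j"
    using \<delta>_pos \<delta>K by (simp add: t_def field_simps)
  moreover have "cost x = c' i - logistic_acceptance \<gamma> \<delta> i j x * (c' i - x)"
    by (simp add: offer_cost_def algebra_simps)
  ultimately show ?thesis by (simp add: P)
qed

lemma offer_cost_logistic_zero: "cost 0 = c' i"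
  by (simp add: offer_cost_def logistic_acceptance_def)

lemma offer_cost_logistic_compensation_le:
  assumes "0 < K"
  shows "cost K \<le> cost x"
proof -
  have w: "0 < w" by (simp add: lambert_W_pos)
  have K: "cost K = c' i - w / \<delta> i j"
    using offer_cost_logistic[of K] assms w by simp
  show ?thesis
  proof (cases "x = 0")
    case True
    then show ?thesis using K w \<delta>_pos by (simp add: offer_cost_logistic_zero)
  next
    case False
    define t where "t = \<delta> i j * (x - K)"
    have "(1 + w - t) / (exp (- t) + w) \<le> 1"
      using exp_ge_add_one_self[of "- t"] w by (simp add: add_pos_pos)
    then have "w / \<delta> i j * ((1 + w - t) / (exp (- t) + w)) \<le> w / \<delta> i j * 1"
      using w \<delta>_pos by (intro mult_left_mono) auto
    then show ?thesis
      using offer_cost_logistic[OF False] K by (simp add: t_def)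
  qed
qed

lemma offer_cost_logistic_strict_mono:
  assumes "K \<le> y" "0 < y" "y < x"
  shows "cost y < cost x"
proof -
  have w: "0 < w" by (simp add: lambert_W_pos)
  have "(1 + w - \<delta> i j * (x - K)) / (exp (- (\<delta> i j * (x - K))) + w)
      < (1 + w - \<delta> i j * (y - K)) / (exp (- (\<delta> i j * (y - K))) + w)"
    using assms \<delta>_pos w by (intro saving_strict_antimono) auto
  then have "w / \<delta> i j * ((1 + w - \<delta> i j * (x - K)) / (exp (- (\<delta> i j * (x - K))) + w))
      < w / \<delta> i j * ((1 + w - \<delta> i j * (y - K)) / (exp (- (\<delta> i j * (y - K))) + w))"
    using w \<delta>_pos by (intro mult_strict_left_mono) auto
  then show ?thesis
    using assms by (simp add: offer_cost_logistic)
qed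

end

lemma optimal_compensation_minimal:
  assumes "finite I" "finite J" and opt: "optimal_solution I J c c' P A C"
    and ij: "(i, j) \<in> A" and "0 \<le> x"
  shows "offer_cost c' P i j (C i j) \<le> offer_cost c' P i j x"
proof -
  define C' where "C' = (\<lambda>k l. if (k, l) = (i, j) then x else C k l)"
  have asg: "one_to_one_assignment I J A" and "\<forall>(k, l)\<in>A. 0 \<le> C k l"
    using opt by (auto simp: optimal_solution_def feasible_solution_def)
  with \<open>0 \<le> x\<close> have "feasible_solution I J A C'"
    by (auto simp: feasible_solution_def C'_def)
  then have "expected_cost I c c' P A C \<le> expected_cost I c c' P A C'"
    using opt by (simp add: optimal_solution_def)
  moreover have "finite A"
    using asg assms(1,2) finite_subset[of A "I \<times> J"] by (simp add: one_to_one_assignment_def)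
  moreover have "(\<Sum>(k, l)\<in>A - {(i, j)}. offer_cost c' P k l (C' k l) - c k)
      = (\<Sum>(k, l)\<in>A - {(i, j)}. offer_cost c' P k l (C k l) - c k)"
    by (intro sum.cong) (auto simp: C'_def split: if_splits)
  ultimately show ?thesis
    using asg assms(1) ij by (simp add: expected_cost_eq sum.remove[of A "(i, j)"] C'_def)
qed

theorem proposition2:
  fixes I :: "'i set" and J :: "'j set"
    and c c' :: "'i \<Rightarrow> real" and \<gamma> \<delta> :: "'i \<Rightarrow> 'j \<Rightarrow> real"
  assumes inst: "capcab I J c c' (logistic_acceptance \<gamma> \<delta>)"
    and \<delta>_pos: "\<forall>i\<in>I. \<forall>j\<in>J. 0 < \<delta> i j"
    and attained: "(\<forall>i\<in>I. \<forall>j\<in>J. 0 < logistic_compensation c' \<gamma> \<delta> i j) \<or>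
      (\<exists>A C. optimal_solution I J c c' (logistic_acceptance \<gamma> \<delta>) A C)"
  shows "\<exists>A C. optimal_solution I J c c' (logistic_acceptance \<gamma> \<delta>) A C \<and>
    (\<forall>i\<in>I. \<forall>j\<in>J. C i j = logistic_compensation c' \<gamma> \<delta> i j)"
proof -
  let ?P = "logistic_acceptance \<gamma> \<delta>"
  let ?K = "logistic_compensation c' \<gamma> \<delta>"
  let ?cost = "expected_cost I c c' ?P"
  let ?asg = "one_to_one_assignment I J"
  have fin: "finite I" "finite J" and cc': "\<And>i. i \<in> I \<Longrightarrow> c i \<le> c' i"
    using inst by (auto simp: capcab_def)
  have K_le: "offer_cost c' ?P i j (?K i j) \<le> offer_cost c' ?P i j x"
    if "i \<in> I" "j \<in> J" "0 < ?K i j" for i j x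
    using that \<delta>_pos by (intro offer_cost_logistic_compensation_le) auto
  have "\<exists>A. optimal_solution I J c c' ?P A ?K"
    using attained
  proof (elim disjE exE)
    assume pos: "\<forall>i\<in>I. \<forall>j\<in>J. 0 < ?K i j"
    have "finite {A. ?asg A}"
      using fin by (auto intro: finite_subset[of _ "Pow (I \<times> J)"] simp: one_to_one_assignment_def)
    moreover have "?asg {}"
      by (simp add: one_to_one_assignment_def)
    ultimately obtain A where A: "?asg A" "\<And>A'. ?asg A' \<Longrightarrow> ?cost A ?K \<le> ?cost A' ?K"
      using ex_is_arg_min_if_finite[of "{A. ?asg A}" "\<lambda>A. ?cost A ?K"]
      by (auto simp: is_arg_min_linorder)
    have "?cost A ?K \<le> ?cost A' C'" if "feasible_solution I J A' C'" for A' C'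
    proof -
      have asg': "?asg A'" using that by (simp add: feasible_solution_def)
      have "?cost A ?K \<le> ?cost A' ?K" by (rule A(2)[OF asg'])
      also have "\<dots> \<le> ?cost A' C'"
        using asg' pos fin
        by (fastforce simp: expected_cost_eq one_to_one_assignment_def intro!: sum_mono K_le)
      finally show ?thesis .
    qed
    moreover have "feasible_solution I J A ?K"
      using A(1) pos by (force simp: feasible_solution_def one_to_one_assignment_def)
    ultimately show ?thesis by (auto simp: optimal_solution_def)
  next
    fix A C
    assume opt: "optimal_solution I J c c' ?P A C"
    define B where "B = {(i, j) \<in> A. 0 < ?K i j}"
    have asg: "?asg A" and C_nonneg: "\<And>i j. (i, j) \<in> A \<Longrightarrow> 0 \<le> C i j"
      using opt by (auto simp: optimal_solution_def feasible_solution_def)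
    have AIJ: "A \<subseteq> I \<times> J" and "finite A" and "B \<subseteq> A"
      using asg fin finite_subset[of A "I \<times> J"]
      by (auto simp: one_to_one_assignment_def B_def)
    have asgB: "?asg B"
      using asg \<open>B \<subseteq> A\<close> by (auto simp: one_to_one_assignment_def intro: inj_on_subset)
    have C0: "C i j = 0" if "(i, j) \<in> A - B" for i j
    proof (rule ccontr)
      assume "C i j \<noteq> 0"
      with that C_nonneg have "0 < C i j" by fastforce
      moreover have "?K i j \<le> 0" "0 < \<delta> i j"
        using that \<delta>_pos AIJ by (auto simp: B_def)
      ultimately have "offer_cost c' ?P i j (C i j / 2) < offer_cost c' ?P i j (C i j)"
        by (intro offer_cost_logistic_strict_mono) auto
      moreover have "offer_cost c' ?P i j (C i j) \<le> offer_cost c' ?P i j (C i j / 2)"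
        using that \<open>0 < C i j\<close> by (intro optimal_compensation_minimal[OF fin opt]) auto
      ultimately show False by simp
    qed
    have "(\<Sum>(i, j)\<in>B. offer_cost c' ?P i j (?K i j) - c i)
        \<le> (\<Sum>(i, j)\<in>B. offer_cost c' ?P i j (C i j) - c i)"
      using AIJ by (auto simp: B_def intro!: sum_mono K_le)
    also have "\<dots> \<le> (\<Sum>(i, j)\<in>A. offer_cost c' ?P i j (C i j) - c i)"
      using AIJ C0 cc' \<open>finite A\<close> \<open>B \<subseteq> A\<close>
      by (intro sum_mono2) (auto simp: offer_cost_def logistic_acceptance_def)
    finally have "?cost B ?K \<le> ?cost A C"
      using fin asg asgB by (simp add: expected_cost_eq)
    moreover have "feasible_solution I J B ?K"
      using asgB by (auto simp: feasible_solution_def B_def)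
    ultimately show ?thesis
      using opt by (auto simp: optimal_solution_def intro: order_trans)
  qed
  then show ?thesis by blast
qed

end
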